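(* Let $d\ge1$, let $\Omega\subset\mathbb{R}^d$ be a non-empty bounded open set and let $\theta\in\mathcal{S}$. (1) The measurable set $\partial\Omega\setminus\partial_\theta\Omega$ is $\mu_\theta$-negligible, that is, $\mu_\theta(\partial\Omega\setminus\partial_\theta\Omega)=0$. (2) Let $A$ be a non-empty subset of $\partial\Omega$. Then $A$ is $\mu_\theta$-negligible if and only if $\mathcal{P}_\theta(A\cap\partial_\theta\Omega)$ is $\lambda^{d-1}$-negligible.
   Context: $\partial\Omega=\overline\Omega\setminus\Omega$, $\mathcal{S}=\{x\in\mathbb{R}^d:|x|=1\}$ (Euclidean norm). For $\theta\in\mathcal{S}$ and $x\in\Omega$, $\delta_\theta(x)=\sup\{s\in[0,+\infty):\ \forall t\in[0,s[,\ x+t\theta\in\Omega\}$ and $z_\theta(x)=x+\delta_\theta(x)\theta\in\partial\Omega$; $\partial_\theta\Omega=z_\theta(\Omega)\subset\partial\Omega$. The directional measure $\mu_\theta$ is the finite measure on the Borel sets of $\partial\Omega$ given by $\mu_\theta(A)=\int_\Omega\chi_A(z_\theta(x))\,\mathrm{d}x$, where $\chi_A$ is the characteristic function of $A$. $H_\theta$ is the hyperplane through $0$ orthogonal to $\theta$, $\mathcal{P}_\theta(x)=x-(x\cdot\theta)\theta$ is the orthogonal projection onto $H_\theta$, and $\lambda^{d-1}$ is the $(d-1)$-dimensional Lebesgue measure on $H_\theta$. An arbitrary subset is negligible for a measure ($\mu_\theta$ on the Borel sets of $\partial\Omega$, $\lambda^{d-1}$ on the Borel sets of $H_\theta$) if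 it is included in a Borel set of measure zero. *)

theory Defs
  imports "HOL-Analysis.Analysis"
begin

text \<open>The space \<open>\<real>\<^sup>d\<close>, \<open>d \<ge> 1\<close>, is an arbitrary type of class \<^class>\<open>euclidean_space\<close>;
  its norm is the Euclidean one and \<^const>\<open>lborel\<close> is \<open>d\<close>-dimensional Lebesgue measure.\<close>

definition bd :: "'a::euclidean_space set \<Rightarrow> 'a set" where
  "bd \<Omega> = closure \<Omega> - \<Omega>"

text \<open>For bounded \<open>\<Omega>\<close>, \<open>x \<in> \<Omega>\<close> and \<open>\<theta> \<noteq> 0\<close> the set below is non-empty and bounded above,
  so the real supremum is the intended one.\<close>

definition dir_dist :: "'a::euclidean_space set \<Rightarrow> 'a \<Rightarrow> 'a \<Rightarrow> real" where
  "dir_dist \<Omega> \<theta> x = Sup {s. 0 \<le> s \<and> (\<forall>t\<in>{0..<s}. x + t *\<^sub>R \<theta> \<in> \<Omega>)}"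

definition dir_proj :: "'a::euclidean_space set \<Rightarrow> 'a \<Rightarrow> 'a \<Rightarrow> 'a" where
  "dir_proj \<Omega> \<theta> x = x + dir_dist \<Omega> \<theta> x *\<^sub>R \<theta>"

definition dir_bd :: "'a::euclidean_space set \<Rightarrow> 'a \<Rightarrow> 'a set" where
  "dir_bd \<Omega> \<theta> = dir_proj \<Omega> \<theta> ` \<Omega>"

text \<open>\<^const>\<open>measure_of\<close> yields the intended measure only for countably additive set functions;
  see \<open>emeasure_dir_measure\<close> below.\<close>

definition dir_measure :: "'a::euclidean_space set \<Rightarrow> 'a \<Rightarrow> 'a measure" where
  "dir_measure \<Omega> \<theta> = measure_of (bd \<Omega>) (sets (restrict_space borel (bd \<Omega>)))
     (\<lambda>A. \<integral>\<^sup>+x\<in>\<Omega>. indicator A (dir_proj \<Omega> \<theta> x) \<partial>lborel)"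

definition orth_hyperplane :: "'a::euclidean_space \<Rightarrow> 'a set" where
  "orth_hyperplane \<theta> = {y. y \<bullet> \<theta> = 0}"

definition orth_proj :: "'a::euclidean_space \<Rightarrow> 'a \<Rightarrow> 'a" where
  "orth_proj \<theta> x = x - (x \<bullet> \<theta>) *\<^sub>R \<theta>"

definition orthonormal_basis_of :: "'a::euclidean_space set \<Rightarrow> 'a set \<Rightarrow> bool" where
  "orthonormal_basis_of V B \<longleftrightarrow>
     pairwise orthogonal B \<and> (\<forall>b\<in>B. norm b = 1) \<and> span B = V"

text \<open>Lebesgue measure on \<open>V\<close> (a linear subspace) is product Lebesgue measure transported along
  orthonormal coordinates, exactly as \<^const>\<open>lborel\<close> is defined with the basis \<^const>\<open>Basis\<close>.
  By rotation invariance of Lebesgue measure the choice of the orthonormal basis is immaterial.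
  If \<open>V = {0}\<close>, then \<open>B = {}\<close> and the result is the unit mass at \<open>0\<close>.\<close>

definition subspace_lborel :: "'a::euclidean_space set \<Rightarrow> 'a measure" where
  "subspace_lborel V = (let B = (SOME B. orthonormal_basis_of V B) in
     distr (\<Pi>\<^sub>M b\<in>B. (lborel :: real measure)) (restrict_space borel V)
       (\<lambda>c. \<Sum>b\<in>B. c b *\<^sub>R b))"

definition negligible_wrt :: "'a measure \<Rightarrow> 'a set \<Rightarrow> bool" where
  "negligible_wrt M A \<longleftrightarrow> (\<exists>N\<in>sets M. emeasure M N = 0 \<and> A \<subseteq> N)"

lemma orthonormal_basis_of_ex:
  assumes "subspace V"
  shows "orthonormal_basis_of V (SOME B. orthonormal_basis_of V B)"
proof -
  obtain B where "B \<subseteq> V" "pairwise orthogonal B" "\<And>x. x \<in> B \<Longrightarrow> norm x = 1"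
    "independent B" "card B = dim V" "span B = V"
    using orthonormal_basis_subspace[OF assms] by metis
  then have "\<exists>B. orthonormal_basis_of V B"
    unfolding orthonormal_basis_of_def by blast
  then show ?thesis by (rule someI_ex)
qed

lemma subspace_orth_hyperplane: "subspace (orth_hyperplane \<theta>)"
  unfolding orth_hyperplane_def by (auto simp: subspace_def inner_add_left)

context
  fixes \<Omega> :: "'a::euclidean_space set" and \<theta> :: 'a
  assumes open_dom: "open \<Omega>" and bounded_dom: "bounded \<Omega>" and unit_dir: "norm \<theta> = 1"
begin

lemma dir_set_bdd_above:
  "bdd_above {s. 0 \<le> s \<and> (\<forall>t\<in>{0..<s}. x + t *\<^sub>R \<theta> \<in> \<Omega>)}"
proof -
  obtain R where R: "\<And>y. y \<in> \<Omega> \<Longrightarrow> norm y \<le> R"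
    using bounded_dom unfolding bounded_iff by blast
  have "s \<le> 2 * (\<bar>R\<bar> + norm x)" if s: "0 \<le> s" "\<forall>t\<in>{0..<s}. x + t *\<^sub>R \<theta> \<in> \<Omega>" for s
  proof (cases "s = 0")
    case False
    with s have "x + (s/2) *\<^sub>R \<theta> \<in> \<Omega>" by auto
    then have "norm (x + (s/2) *\<^sub>R \<theta>) \<le> R" by (rule R)
    moreover have "norm ((s/2) *\<^sub>R \<theta>) \<le> norm (x + (s/2) *\<^sub>R \<theta>) + norm x"
      using norm_triangle_ineq4[of "x + (s/2) *\<^sub>R \<theta>" x] by simp
    moreover have "norm ((s/2) *\<^sub>R \<theta>) = s/2" using s unit_dir by simp
    ultimately have "s/2 \<le> R + norm x" by (metis add_right_mono order_trans)
    then have "s \<le> 2 * (R + norm x)" by simp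
    also have "\<dots> \<le> 2 * (\<bar>R\<bar> + norm x)" by simp
    finally show ?thesis .
  qed simp
  then show ?thesis by (intro bdd_aboveI) auto
qed

lemma less_dir_dist_iff:
  assumes "0 \<le> a"
  shows "a < dir_dist \<Omega> \<theta> x \<longleftrightarrow> (\<exists>m>a. \<forall>t\<in>{0..m}. x + t *\<^sub>R \<theta> \<in> \<Omega>)"
proof
  let ?S = "{s. 0 \<le> s \<and> (\<forall>t\<in>{0..<s}. x + t *\<^sub>R \<theta> \<in> \<Omega>)}"
  have ne: "?S \<noteq> {}" by (auto intro: exI[of _ 0])
  {
    assume "a < dir_dist \<Omega> \<theta> x"
    then obtain s where s: "s \<in> ?S" "a < s"
      unfolding dir_dist_def using less_cSup_iff[OF ne dir_set_bdd_above] by blast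
    then have "\<forall>t\<in>{0..(a+s)/2}. x + t *\<^sub>R \<theta> \<in> \<Omega>" by auto
    with s show "\<exists>m>a. \<forall>t\<in>{0..m}. x + t *\<^sub>R \<theta> \<in> \<Omega>"
      by (intro exI[of _ "(a+s)/2"]) auto
  }
  assume "\<exists>m>a. \<forall>t\<in>{0..m}. x + t *\<^sub>R \<theta> \<in> \<Omega>"
  then obtain m where m: "m > a" "\<forall>t\<in>{0..m}. x + t *\<^sub>R \<theta> \<in> \<Omega>" by blast
  then have "m \<in> ?S" using assms by auto
  with m(1) show "a < dir_dist \<Omega> \<theta> x"
    unfolding dir_dist_def using less_cSup_iff[OF ne dir_set_bdd_above] by blast
qed

lemma dir_dist_nonneg: "0 \<le> dir_dist \<Omega> \<theta> x"
  unfolding dir_dist_def by (rule cSup_upper[OF _ dir_set_bdd_above]) auto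

lemma open_segment_dom: "open {x. \<forall>t\<in>{0..m}. x + t *\<^sub>R \<theta> \<in> \<Omega>}"
proof -
  have "closed (\<Union>x\<in>- \<Omega>. \<Union>y\<in>(\<lambda>t. t *\<^sub>R \<theta>) ` {0..m}. {x - y})"
    using open_dom
    by (intro closed_compact_differences compact_continuous_image continuous_intros) auto
  then have "open (- (\<Union>x\<in>- \<Omega>. \<Union>y\<in>(\<lambda>t. t *\<^sub>R \<theta>) ` {0..m}. {x - y}))"
    by (rule open_Compl)
  moreover have "- (\<Union>x\<in>- \<Omega>. \<Union>y\<in>(\<lambda>t. t *\<^sub>R \<theta>) ` {0..m}. {x - y})
      = {x. \<forall>t\<in>{0..m}. x + t *\<^sub>R \<theta> \<in> \<Omega>}" (is "- ?L = ?R")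
  proof -
    have "x \<in> ?L \<longleftrightarrow> x \<notin> ?R" for x
    proof
      assume "x \<notin> ?R"
      then obtain t where "t \<in> {0..m}" "x + t *\<^sub>R \<theta> \<in> - \<Omega>" by blast
      moreover have "x = (x + t *\<^sub>R \<theta>) - t *\<^sub>R \<theta>" by simp
      ultimately show "x \<in> ?L" by blast
    next
      assume "x \<in> ?L"
      then obtain y t where y: "y \<notin> \<Omega>" "t \<in> {0..m}" "x = y - t *\<^sub>R \<theta>" by blast
      then have "x + t *\<^sub>R \<theta> \<notin> \<Omega>" by (metis diff_add_cancel)
      with y(2) show "x \<notin> ?R" by blast
    qed
    then show ?thesis by blast
  qed
  ultimately show ?thesis by (rule back_subst)
qed

lemma dir_dist_measurable: "dir_dist \<Omega> \<theta> \<in> borel_measurable borel"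
  unfolding borel_measurable_iff_greater
proof
  fix a :: real
  have "{w. a < dir_dist \<Omega> \<theta> w} \<in> sets borel"
  proof (cases "a < 0")
    case True
    then have "{w. a < dir_dist \<Omega> \<theta> w} = UNIV"
      using dir_dist_nonneg by (auto intro: less_le_trans)
    then show ?thesis by simp
  next
    case False
    then have "{w. a < dir_dist \<Omega> \<theta> w}
        = (\<Union>m\<in>{a<..}. {x. \<forall>t\<in>{0..m}. x + t *\<^sub>R \<theta> \<in> \<Omega>})"
      by (subst less_dir_dist_iff) auto
    also have "open \<dots>" using open_segment_dom by blast
    finally show ?thesis by simp
  qed
  then show "{w \<in> space borel. a < dir_dist \<Omega> \<theta> w} \<in> sets borel" by simp
qed

lemma dir_proj_measurable: "dir_proj \<Omega> \<theta> \<in> borel_measurable borel"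
  unfolding dir_proj_def
  by (intro borel_measurable_add borel_measurable_scaleR dir_dist_measurable
      borel_measurable_const measurable_ident_sets[OF refl])

lemma dir_proj_in_bd:
  assumes x: "x \<in> \<Omega>"
  shows "dir_proj \<Omega> \<theta> x \<in> bd \<Omega>"
proof -
  define d where "d = dir_dist \<Omega> \<theta> x"
  have inside: "x + t *\<^sub>R \<theta> \<in> \<Omega>" if t: "0 \<le> t" "t < d" for t
  proof -
    obtain m where "m > t" "\<forall>t\<in>{0..m}. x + t *\<^sub>R \<theta> \<in> \<Omega>"
      using less_dir_dist_iff[of t x] t unfolding d_def by blast
    then show ?thesis using t(1) by simp
  qed
  have ext: "\<exists>m>t. \<forall>u\<in>{t..m}. x + u *\<^sub>R \<theta> \<in> \<Omega>" if t: "x + t *\<^sub>R \<theta> \<in> \<Omega>" for t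
  proof -
    obtain e where e: "e > 0" "ball (x + t *\<^sub>R \<theta>) e \<subseteq> \<Omega>"
      using openE[OF open_dom t] by metis
    have "x + u *\<^sub>R \<theta> \<in> ball (x + t *\<^sub>R \<theta>) e" if "u \<in> {t..t + e/2}" for u
    proof -
      have "dist (x + t *\<^sub>R \<theta>) (x + u *\<^sub>R \<theta>) = norm ((t - u) *\<^sub>R \<theta>)"
        by (simp add: dist_norm algebra_simps)
      also have "\<dots> < e" using that e unit_dir by auto
      finally show ?thesis by simp
    qed
    with e show ?thesis by (intro exI[of _ "t + e/2"]) auto
  qed
  have "x + d *\<^sub>R \<theta> \<notin> \<Omega>"
  proof
    assume "x + d *\<^sub>R \<theta> \<in> \<Omega>"
    then obtain m where m: "m > d" "\<forall>u\<in>{d..m}. x + u *\<^sub>R \<theta> \<in> \<Omega>" using ext by blast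
    have "\<forall>t\<in>{0..m}. x + t *\<^sub>R \<theta> \<in> \<Omega>"
    proof
      fix t assume "t \<in> {0..m}"
      then show "x + t *\<^sub>R \<theta> \<in> \<Omega>" using inside[of t] m(2) by (cases "t < d") simp_all
    qed
    then have "d < d"
      using m(1) less_dir_dist_iff[of d x] dir_dist_nonneg[of x] unfolding d_def by blast
    then show False by simp
  qed
  moreover have "x + d *\<^sub>R \<theta> \<in> closure \<Omega>"
  proof -
    have "d > 0"
    proof -
      have "x + 0 *\<^sub>R \<theta> \<in> \<Omega>" using x by simp
      then show ?thesis using less_dir_dist_iff[of 0 x] ext[of 0] unfolding d_def by blast
    qed
    moreover have "eventually (\<lambda>t. t \<in> {0<..<d}) (at_left d)"
      using \<open>d > 0\<close> by (rule eventually_at_leftI[rotated]) auto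
    then have "eventually (\<lambda>t. x + t *\<^sub>R \<theta> \<in> closure \<Omega>) (at_left d)"
    proof eventually_elim
      case (elim t)
      then have "x + t *\<^sub>R \<theta> \<in> \<Omega>" by (intro inside) auto
      then show ?case by (rule subsetD[OF closure_subset])
    qed
    moreover have "((\<lambda>t. x + t *\<^sub>R \<theta>) \<longlongrightarrow> x + d *\<^sub>R \<theta>) (at_left d)"
      by (intro tendsto_intros)
    ultimately show ?thesis
      using Lim_in_closed_set[OF closed_closure _ trivial_limit_at_left_real] by metis
  qed
  ultimately show ?thesis unfolding bd_def dir_proj_def d_def by simp
qed

lemma dir_measure_eq_distr:
  "dir_measure \<Omega> \<theta> =
     distr (restrict_space lborel \<Omega>) (restrict_space borel (bd \<Omega>)) (dir_proj \<Omega> \<theta>)"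
  (is "_ = ?D")
proof -
  have meas: "dir_proj \<Omega> \<theta> \<in> restrict_space lborel \<Omega> \<rightarrow>\<^sub>M restrict_space borel (bd \<Omega>)"
    by (intro measurable_restrict_space2 measurable_restrict_space1)
      (use dir_proj_measurable dir_proj_in_bd in \<open>auto simp: space_restrict_space\<close>)
  have em: "emeasure ?D A = (\<integral>\<^sup>+x\<in>\<Omega>. indicator A (dir_proj \<Omega> \<theta> x) \<partial>lborel)"
    if A: "A \<in> sets (restrict_space borel (bd \<Omega>))" for A
  proof -
    have \<Omega>: "\<Omega> \<in> sets lborel" using open_dom by simp
    have "emeasure ?D A = (\<integral>\<^sup>+y. indicator A y \<partial>?D)"
      using A by simp
    also have "\<dots> = (\<integral>\<^sup>+x. indicator A (dir_proj \<Omega> \<theta> x) \<partial>restrict_space lborel \<Omega>)"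
      using A by (intro nn_integral_distr[OF meas]) auto
    also have "\<dots> = (\<integral>\<^sup>+x\<in>\<Omega>. indicator A (dir_proj \<Omega> \<theta> x) \<partial>lborel)"
      using \<Omega> by (intro nn_integral_restrict_space) simp
    finally show ?thesis .
  qed
  have "?D = measure_of (space ?D) (sets ?D) (emeasure ?D)"
    by (rule measure_of_of_measure[symmetric])
  also have "space ?D = bd \<Omega>" by (simp add: space_restrict_space)
  also have "measure_of (bd \<Omega>) (sets ?D) (emeasure ?D) = dir_measure \<Omega> \<theta>"
    unfolding dir_measure_def sets_distr
  proof (rule measure_of_eq)
    show "sets (restrict_space borel (bd \<Omega>)) \<subseteq> Pow (bd \<Omega>)"
      by (auto simp: sets_restrict_space)
    have "sigma_sets (space ?D) (sets ?D) = sets ?D"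
      by (rule sets.sigma_sets_eq)
    then show "emeasure ?D A = (\<integral>\<^sup>+x\<in>\<Omega>. indicator A (dir_proj \<Omega> \<theta> x) \<partial>lborel)"
      if "A \<in> sigma_sets (bd \<Omega>) (sets (restrict_space borel (bd \<Omega>)))" for A
      using that em by (simp add: space_restrict_space)
  qed
  finally show ?thesis by simp
qed

lemma emeasure_dir_measure:
  assumes "A \<in> sets (restrict_space borel (bd \<Omega>))"
  shows "emeasure (dir_measure \<Omega> \<theta>) A
    = (\<integral>\<^sup>+x\<in>\<Omega>. indicator A (dir_proj \<Omega> \<theta> x) \<partial>lborel)"
proof -
  have meas: "dir_proj \<Omega> \<theta> \<in> restrict_space lborel \<Omega> \<rightarrow>\<^sub>M restrict_space borel (bd \<Omega>)"
    by (intro measurable_restrict_space2 measurable_restrict_space1)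
      (use dir_proj_measurable dir_proj_in_bd in \<open>auto simp: space_restrict_space\<close>)
  have "emeasure (dir_measure \<Omega> \<theta>) A = (\<integral>\<^sup>+y. indicator A y \<partial>dir_measure \<Omega> \<theta>)"
    using assms by (simp add: dir_measure_eq_distr)
  also have "\<dots> = (\<integral>\<^sup>+x. indicator A (dir_proj \<Omega> \<theta> x) \<partial>restrict_space lborel \<Omega>)"
    unfolding dir_measure_eq_distr using assms by (intro nn_integral_distr[OF meas]) auto
  also have "\<dots> = (\<integral>\<^sup>+x\<in>\<Omega>. indicator A (dir_proj \<Omega> \<theta> x) \<partial>lborel)"
    using open_dom by (intro nn_integral_restrict_space) simp
  finally show ?thesis .
qed

end

end

theory Submission
  imports Defs
begin

text \<open>
  A Borel set is Lebesgue null iff almost every line parallel to \<open>\<theta>\<close> meets it in a null set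
  (Fubini in orthonormal coordinates adapted to \<open>H\<^sub>\<theta> \<oplus> \<real>\<theta>\<close>), and \<open>\<P>\<^sub>\<theta>(z\<^sub>\<theta>(x)) = \<P>\<^sub>\<theta>(x)\<close>. If
  \<open>\<P>\<^sub>\<theta>(A \<inter> \<partial>\<^sub>\<theta>\<Omega>)\<close> lies in a null set \<open>N\<close>, then \<open>A\<close> lies in \<open>\<P>\<^sub>\<theta>\<^sup>-\<^sup>1(N) \<union> (\<partial>\<Omega> - \<partial>\<^sub>\<theta>\<Omega>)\<close>, which \<open>z\<^sub>\<theta>\<close>
  pulls back into the null cylinder over \<open>N\<close>. Conversely, each \<open>z \<in> A \<inter> \<partial>\<^sub>\<theta>\<Omega>\<close> is the end point of a
  segment \<open>]z - s\<theta>, z[ \<subseteq> \<Omega>\<close> mapped to \<open>z\<close> by \<open>z\<^sub>\<theta>\<close>, so the line over \<open>\<P>\<^sub>\<theta>(z)\<close> meets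
  \<open>z\<^sub>\<theta>\<^sup>-\<^sup>1(A)\<close> in positive length; this excludes almost all base points without any measurability of
  the projected set. Only null sets matter, so the invariance of Lebesgue measure under rotations is
  needed only in the weak form that linear isomorphisms preserve negligible sets.
\<close>

section \<open>Lebesgue null sets in linear coordinates\<close>

lemma emeasure_lborel_eq_0_iff_negligible:
  assumes "N \<in> sets borel"
  shows "emeasure lborel N = 0 \<longleftrightarrow> negligible N"
  using assms by (simp add: negligible_iff_emeasure0)

text \<open>\<open>lborel\<close> is determined by its values on boxes, and these are products of
  interval lengths, whatever the index set. The index set \<open>B\<close> is free because later
  coordinates are indexed by the vectors of a chosen basis rather than by
  \<open>Basis\<close>.\<close>

lemma lborel_eq_distr_reindexed:
  fixes \<beta> :: "'a::euclidean_space \<Rightarrow> 'i"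
  assumes \<beta>: "bij_betw \<beta> Basis B"
  shows "distr (\<Pi>\<^sub>M b\<in>B. lborel) borel (\<lambda>f. \<Sum>i\<in>Basis. f (\<beta> i) *\<^sub>R i) = (lborel :: 'a measure)"
proof (rule lborel_eqI[symmetric])
  interpret product_sigma_finite "\<lambda>_::'i. lborel :: real measure" ..
  have fin: "finite B" using bij_betw_finite[OF \<beta>] by simp
  have [simp]: "\<beta> i \<in> B" if "i \<in> Basis" for i using bij_betwE[OF \<beta>] that by blast
  have meas: "(\<lambda>f. \<Sum>i\<in>Basis. f (\<beta> i) *\<^sub>R i) \<in> (\<Pi>\<^sub>M b\<in>B. (lborel :: real measure)) \<rightarrow>\<^sub>M (borel :: 'a measure)"
    by measurable
  fix l u :: 'a assume le: "\<And>b. b \<in> Basis \<Longrightarrow> l \<bullet> b \<le> u \<bullet> b"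
  define \<gamma> where "\<gamma> = inv_into Basis \<beta>"
  have \<gamma>: "bij_betw \<gamma> B Basis" unfolding \<gamma>_def by (rule bij_betw_inv_into[OF \<beta>])
  have \<beta>\<gamma>: "\<beta> (\<gamma> b) = b" if "b \<in> B" for b
    unfolding \<gamma>_def using \<beta> that by (simp add: bij_betw_inv_into_right)
  have \<gamma>\<beta>: "\<gamma> (\<beta> i) = i" if "i \<in> Basis" for i
    unfolding \<gamma>_def using \<beta> that by (simp add: bij_betw_inv_into_left)
  \<comment> \<open>The preimage of a box is again a box: the side at index \<open>b\<close> is the
    one that belongs to the standard basis vector \<gamma> \<open>b\<close>.\<close>
  have "(\<lambda>f. \<Sum>i\<in>Basis. f (\<beta> i) *\<^sub>R i) -` box l u \<inter> space (\<Pi>\<^sub>M b\<in>B. lborel)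
      = (\<Pi>\<^sub>E b\<in>B. {l \<bullet> \<gamma> b <..< u \<bullet> \<gamma> b})" (is "?L = ?R")
  proof -
    have "(\<forall>i\<in>Basis. l \<bullet> i < f (\<beta> i) \<and> f (\<beta> i) < u \<bullet> i)
        \<longleftrightarrow> (\<forall>b\<in>B. l \<bullet> \<gamma> b < f b \<and> f b < u \<bullet> \<gamma> b)" for f
      unfolding bij_betw_imp_surj_on[OF \<beta>, symmetric] by (simp add: \<gamma>\<beta>)
    then show ?thesis by (simp add: set_eq_iff space_PiM mem_box PiE_iff)
  qed
  then have "emeasure (distr (\<Pi>\<^sub>M b\<in>B. lborel) borel (\<lambda>f. \<Sum>i\<in>Basis. f (\<beta> i) *\<^sub>R i)) (box l u)
      = (\<Prod>b\<in>B. emeasure lborel {l \<bullet> \<gamma> b <..< u \<bullet> \<gamma> b})"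
    using fin by (subst emeasure_distr[OF meas]) (simp_all add: emeasure_PiM)
  also have "\<dots> = (\<Prod>i\<in>Basis. emeasure lborel {l \<bullet> i <..< u \<bullet> i})"
    using prod.reindex_bij_betw[OF \<gamma>] .
  also have "\<dots> = (\<Prod>i\<in>Basis. ennreal ((u - l) \<bullet> i))"
    using le by (intro prod.cong) (simp_all add: inner_diff_left)
  also have "\<dots> = ennreal (\<Prod>i\<in>Basis. (u - l) \<bullet> i)"
    using le by (intro prod_ennreal) (simp add: inner_diff_left)
  finally show "emeasure (distr (\<Pi>\<^sub>M b\<in>B. lborel) borel (\<lambda>f. \<Sum>i\<in>Basis. f (\<beta> i) *\<^sub>R i)) (box l u)
      = ennreal (\<Prod>i\<in>Basis. (u - l) \<bullet> i)" .
qed simp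

text \<open>A differentiable map between spaces of equal dimension sends negligible sets to
  negligible sets; this is applied to \<open>L\<close> and to its linear inverse.\<close>

lemma negligible_linear_vimage_iff:
  fixes L :: "'a::euclidean_space \<Rightarrow> 'a"
  assumes "linear L" "surj L"
  shows "negligible (L -` N) \<longleftrightarrow> negligible N"
proof -
  obtain L' where L': "linear L'" "\<And>x. L' (L x) = x" "\<And>x. L (L' x) = x"
    using linear_surjective_isomorphism[OF assms] by blast
  have "N = L ` (L -` N)" using \<open>surj L\<close> by (simp add: surj_image_vimage_eq)
  moreover have "L -` N = L' ` N"
  proof
    show "L -` N \<subseteq> L' ` N" using L'(2) by (metis imageI subsetI vimageD)
    show "L' ` N \<subseteq> L -` N" using L'(3) by auto
  qed
  ultimately show ?thesis
    using negligible_differentiable_image_negligible[OF order_refl _ linear_imp_differentiable_on[OF assms(1)]]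
      negligible_differentiable_image_negligible[OF order_refl _ linear_imp_differentiable_on[OF L'(1)]]
    by metis
qed

text \<open>The coordinate map of \<open>B\<close> factors through standard coordinates: reindex by
  \<beta>, then apply the linear isomorphism \<open>L\<close> that sends each \<open>i\<close> in
  \<open>Basis\<close> to \<beta> \<open>i\<close>. The first factor carries the product measure to
  \<open>lborel\<close>, the second preserves null sets.\<close>

lemma emeasure_lborel_eq_0_iff_AE_coords:
  fixes B :: "'a::euclidean_space set"
  assumes B: "independent B" "span B = UNIV" and N: "N \<in> sets borel"
  shows "emeasure lborel N = 0 \<longleftrightarrow> (AE f in \<Pi>\<^sub>M b\<in>B. lborel. (\<Sum>b\<in>B. f b *\<^sub>R b) \<notin> N)"
proof -
  have "card B = DIM('a)" 
    using indep_card_eq_dim_span[OF B(1)] B(2) by simp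
  then obtain \<beta> where \<beta>: "bij_betw \<beta> (Basis :: 'a set) B"
    using finite_same_card_bij[OF finite_Basis independent_imp_finite[OF B(1)]] by metis
  have [simp]: "\<beta> i \<in> B" if "i \<in> Basis" for i using bij_betwE[OF \<beta>] that by blast
  define L where "L x = (\<Sum>i\<in>Basis. (x \<bullet> i) *\<^sub>R \<beta> i)" for x :: 'a
  have lin: "linear L" unfolding L_def
    by (intro linearI) (simp_all add: inner_add_left scaleR_add_left sum.distrib scaleR_sum_right)
  have "L i = \<beta> i" if "i \<in> Basis" for i :: 'a
    unfolding L_def using that by (simp add: inner_Basis if_distrib[of "\<lambda>x. x *\<^sub>R _"] cong: if_cong)
  then have im: "L ` Basis = B" using \<beta> by (simp add: bij_betw_def)
  have "surj L" using linear_span_image[OF lin, of Basis] im B by simp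
  have L_sum: "L (\<Sum>i\<in>Basis. f (\<beta> i) *\<^sub>R i) = (\<Sum>b\<in>B. f b *\<^sub>R b)" for f
    unfolding L_def using sum.reindex_bij_betw[OF \<beta>, of "\<lambda>b. f b *\<^sub>R b"] by simp
  have LN: "L -` N \<in> sets borel"
    using measurable_sets_borel[OF borel_measurable_continuous_onI[OF
        linear_continuous_on[OF linear_conv_bounded_linear[THEN iffD1, OF lin]]] N] .
  have meas: "(\<lambda>f. \<Sum>i\<in>Basis. f (\<beta> i) *\<^sub>R i) \<in> (\<Pi>\<^sub>M b\<in>B. (lborel :: real measure)) \<rightarrow>\<^sub>M (borel :: 'a measure)"
    by measurable
  have "emeasure lborel N = 0 \<longleftrightarrow> emeasure lborel (L -` N) = 0"
    using N LN negligible_linear_vimage_iff[OF lin \<open>surj L\<close>]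
    by (simp add: emeasure_lborel_eq_0_iff_negligible)
  also have "\<dots> \<longleftrightarrow> (AE x in lborel. x \<notin> L -` N)"
    using LN by (subst AE_iff_null_sets[symmetric]) (auto simp: null_sets_def)
  also have "\<dots> \<longleftrightarrow> (AE f in \<Pi>\<^sub>M b\<in>B. lborel. (\<Sum>i\<in>Basis. f (\<beta> i) *\<^sub>R i) \<notin> L -` N)"
  proof -
    have "{x \<in> space borel. x \<notin> L -` N} \<in> sets borel"
      using borel_comp[OF LN] by (simp add: Compl_eq)
    from AE_distr_iff[OF meas this] show ?thesis
      unfolding lborel_eq_distr_reindexed[OF \<beta>] .
  qed
  finally show ?thesis by (simp add: L_sum)
qed

section \<open>Fubini along the lines parallel to \<theta>\<close>

text \<open>Tonelli for the indicator of the set where \<open>P\<close> fails: a nonnegative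
  integral vanishes iff its integrand vanishes almost everywhere, which is used for the full
  integral and for both iterated ones.\<close>

lemma AE_PiM_insert:
  fixes M :: "'i \<Rightarrow> 'b measure"
  assumes "product_sigma_finite M" "finite I" "i \<notin> I"
    and [measurable]: "Measurable.pred (Pi\<^sub>M (insert i I) M) P"
  shows "(AE f in Pi\<^sub>M (insert i I) M. P f) \<longleftrightarrow> (AE f in Pi\<^sub>M I M. AE t in M i. P (f(i := t)))"
proof -
  interpret product_sigma_finite M by fact
  have m [measurable]: "(\<lambda>f. indicator {f. \<not> P f} f :: ennreal) \<in> borel_measurable (Pi\<^sub>M (insert i I) M)"
    by measurable
  have [measurable]: "(\<lambda>f. \<integral>\<^sup>+t. indicator {f. \<not> P f} (f(i := t)) \<partial>M i) \<in> borel_measurable (Pi\<^sub>M I M)"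
    by measurable
  have "(AE f in Pi\<^sub>M (insert i I) M. P f)
      \<longleftrightarrow> (\<integral>\<^sup>+f. indicator {f. \<not> P f} f \<partial>Pi\<^sub>M (insert i I) M) = 0"
    by (subst nn_integral_0_iff_AE[OF m]) (simp add: indicator_def)
  also have "\<dots> \<longleftrightarrow> (AE f in Pi\<^sub>M I M. (\<integral>\<^sup>+t. indicator {f. \<not> P f} (f(i := t)) \<partial>M i) = 0)"
    by (subst product_nn_integral_insert[OF assms(2,3) m]) (subst nn_integral_0_iff_AE, simp_all)
  also have "\<dots> \<longleftrightarrow> (AE f in Pi\<^sub>M I M. AE t in M i. P (f(i := t)))"
  proof (intro AE_cong)
    fix f assume [measurable]: "f \<in> space (Pi\<^sub>M I M)"
    have "(\<lambda>t. indicator {f. \<not> P f} (f(i := t)) :: ennreal) \<in> borel_measurable (M i)"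
      by measurable
    then show "(\<integral>\<^sup>+t. indicator {f. \<not> P f} (f(i := t)) \<partial>M i) = 0 \<longleftrightarrow> (AE t in M i. P (f(i := t)))"
      by (subst nn_integral_0_iff_AE) (simp_all add: indicator_def)
  qed
  finally show ?thesis .
qed

text \<open>Adjoining \<theta> keeps the set orthogonal and free of 0, hence independent; it spans
  because subtracting from \<open>x\<close> its \<theta>-component leaves a vector of the
  hyperplane.\<close>

lemma orthonormal_basis_of_insert_hyperplane:
  assumes "orthonormal_basis_of (orth_hyperplane \<theta>) B" and "norm \<theta> = 1"
  shows "independent (insert \<theta> B)" "span (insert \<theta> B) = UNIV" "finite B" "\<theta> \<notin> B" "\<And>b. b \<in> B \<Longrightarrow> b \<bullet> \<theta> = 0"
proof -
  have B: "pairwise orthogonal B" "\<And>b. b \<in> B \<Longrightarrow> norm b = 1" "span B = orth_hyperplane \<theta>"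
    using assms(1) by (auto simp: orthonormal_basis_of_def)
  have \<theta>1: "\<theta> \<bullet> \<theta> = 1" using assms(2) by (simp add: dot_square_norm)
  show orth: "\<And>b. b \<in> B \<Longrightarrow> b \<bullet> \<theta> = 0"
    using B(3) span_superset unfolding orth_hyperplane_def by blast
  then show "\<theta> \<notin> B" using \<theta>1 by force
  have "pairwise orthogonal (insert \<theta> B)"
    using B(1) orth by (auto simp: pairwise_insert orthogonal_def inner_commute)
  moreover have "0 \<notin> insert \<theta> B" using B(2) assms(2) by force
  ultimately show ind: "independent (insert \<theta> B)"
    by (rule pairwise_orthogonal_independent)
  then show "finite B" using independent_imp_finite[OF ind] by simp
  have "x \<in> span (insert \<theta> B)" for x
  proof -
    have "x - (x \<bullet> \<theta>) *\<^sub>R \<theta> \<in> span B"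
      unfolding B(3) orth_hyperplane_def by (simp add: inner_diff_left \<theta>1)
    then show ?thesis unfolding span_insert by blast
  qed
  then show "span (insert \<theta> B) = UNIV" by (simp add: set_eq_iff)
qed

text \<open>In the basis \<open>insert \<theta> B\<close> the coordinates split into
  \<open>c\<close>, the base point in the hyperplane, and \<open>t\<close>, the position on the line
  over it.\<close>

lemma emeasure_lborel_eq_0_iff_AE_hyperplane:
  fixes \<theta> :: "'a::euclidean_space"
  assumes B: "orthonormal_basis_of (orth_hyperplane \<theta>) B" and \<theta>: "norm \<theta> = 1" and N: "N \<in> sets borel"
  shows "emeasure lborel N = 0 \<longleftrightarrow>
    (AE c in \<Pi>\<^sub>M b\<in>B. lborel. AE t in lborel. (\<Sum>b\<in>B. c b *\<^sub>R b) + t *\<^sub>R \<theta> \<notin> N)"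
proof -
  note B' = orthonormal_basis_of_insert_hyperplane[OF B \<theta>]
  interpret product_sigma_finite "\<lambda>_::'a. lborel :: real measure" ..
  have eq: "(\<Sum>b\<in>insert \<theta> B. (c(\<theta> := t)) b *\<^sub>R b) = (\<Sum>b\<in>B. c b *\<^sub>R b) + t *\<^sub>R \<theta>" for c :: "'a \<Rightarrow> real" and t
  proof -
    have "(\<Sum>b\<in>B. (c(\<theta> := t)) b *\<^sub>R b) = (\<Sum>b\<in>B. c b *\<^sub>R b)"
      using B'(4) by (intro sum.cong) auto
    then show ?thesis using B'(3,4) by (simp add: add.commute)
  qed
  have meas: "(\<lambda>f. \<Sum>b\<in>insert \<theta> B. f b *\<^sub>R b) \<in> (\<Pi>\<^sub>M b\<in>insert \<theta> B. (lborel :: real measure)) \<rightarrow>\<^sub>M borel"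
    by measurable
  have "Measurable.pred (\<Pi>\<^sub>M b\<in>insert \<theta> B. lborel) (\<lambda>f. (\<Sum>b\<in>insert \<theta> B. f b *\<^sub>R b) \<notin> N)"
    by (rule measurable_compose[OF meas]) (use N in simp)
  from AE_PiM_insert[OF product_sigma_finite_axioms B'(3,4) this] show ?thesis
    unfolding emeasure_lborel_eq_0_iff_AE_coords[OF B'(1,2) N] eq .
qed

lemma borel_measurable_orth_proj: "orth_proj \<theta> \<in> borel_measurable borel"
  unfolding orth_proj_def by (intro borel_measurable_continuous_onI continuous_intros)

section \<open>Null sets of Lebesgue measure on a subspace\<close>

text \<open>The coordinate map \<phi> is a bijection onto \<open>V\<close> with measurable inverse
  \<psi>, so null covers can be moved in both directions. \<open>S\<close> is arbitrary, which
  permits projected sets of unknown measurability.\<close>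

lemma negligible_wrt_subspace_lborel_iff:
  fixes V :: "'a::euclidean_space set"
  assumes V: "subspace V" and B_def: "B = (SOME B. orthonormal_basis_of V B)"
  shows "negligible_wrt (subspace_lborel V) S \<longleftrightarrow>
    S \<subseteq> V \<and> (AE c in \<Pi>\<^sub>M b\<in>B. lborel. (\<Sum>b\<in>B. c b *\<^sub>R b) \<notin> S)"
proof -
  let ?M = "\<Pi>\<^sub>M b\<in>B. (lborel :: real measure)"
  define \<phi> where "\<phi> c = (\<Sum>b\<in>B. c b *\<^sub>R b)" for c :: "'a \<Rightarrow> real"
  have B: "pairwise orthogonal B" "\<And>b. b \<in> B \<Longrightarrow> norm b = 1" "span B = V"
    using orthonormal_basis_of_ex[OF V] by (simp_all add: B_def orthonormal_basis_of_def)
  \<comment> \<open>Finiteness of \<open>B\<close> is not part of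
    \<open>orthonormal_basis_of\<close>; it follows from independence.\<close>
  have "0 \<notin> B" using B(2) by force
  then have fin: "finite B"
    using pairwise_orthogonal_independent[OF B(1)] independent_imp_finite by metis
  have in_V: "\<phi> c \<in> V" for c
    unfolding \<phi>_def B(3)[symmetric] by (intro span_sum span_scale span_base)
  have coord: "\<phi> c \<bullet> b = c b" if "b \<in> B" for c b
  proof -
    have "\<phi> c \<bullet> b = (\<Sum>b'\<in>B. c b' * (b' \<bullet> b))"
      by (simp add: \<phi>_def inner_sum_left)
    also have "\<dots> = (\<Sum>b'\<in>B. if b' = b then c b' else 0)"
    proof (intro sum.cong refl)
      fix b' assume "b' \<in> B"
      show "c b' * (b' \<bullet> b) = (if b' = b then c b' else 0)"
        using B(1) B(2)[OF that] \<open>b' \<in> B\<close> that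
        by (auto simp: pairwise_def orthogonal_def dot_square_norm)
    qed
    finally show ?thesis using fin that by simp
  qed
  have \<phi>_borel: "\<phi> \<in> borel_measurable ?M" unfolding \<phi>_def by measurable
  have \<phi>: "\<phi> \<in> ?M \<rightarrow>\<^sub>M restrict_space borel V"
    by (rule measurable_restrict_space2[OF _ \<phi>_borel]) (use in_V in simp)
  have M_V: "subspace_lborel V = distr ?M (restrict_space borel V) \<phi>"
    unfolding subspace_lborel_def Let_def B_def[symmetric] \<phi>_def[abs_def] ..
  show ?thesis unfolding \<phi>_def[symmetric]
  proof (intro iffI conjI)
    assume "negligible_wrt (subspace_lborel V) S"
    then obtain N where N: "N \<in> sets (restrict_space borel V)"
      "emeasure (distr ?M (restrict_space borel V) \<phi>) N = 0" "S \<subseteq> N"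
      unfolding negligible_wrt_def M_V by auto
    then have "N \<subseteq> V" using sets.sets_into_space by (force simp: space_restrict_space)
    with N(3) show "S \<subseteq> V" by simp
    have "\<phi> -` N \<inter> space ?M \<in> null_sets ?M"
      using N(1,2) \<phi> by (simp add: null_sets_def emeasure_distr measurable_sets)
    then show "AE c in ?M. \<phi> c \<notin> S"
      by (rule AE_I') (use N(3) in auto)
  next
    assume S: "S \<subseteq> V \<and> (AE c in ?M. \<phi> c \<notin> S)"
    then obtain C where C: "C \<in> sets ?M" "emeasure ?M C = 0" "{c \<in> space ?M. \<phi> c \<in> S} \<subseteq> C"
      by (auto elim: AE_E)
    \<comment> \<open>The restriction to \<open>B\<close> makes \<psi> \<open>y\<close> extensional,
      so that it lies in the space of the product measure.\<close>
    define \<psi> where "\<psi> y = (\<lambda>b\<in>B. y \<bullet> b)" for y :: 'a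
    have \<psi>: "\<psi> \<in> restrict_space borel V \<rightarrow>\<^sub>M ?M"
      unfolding \<psi>_def[abs_def] by (intro measurable_restrict measurable_restrict_space1) simp
    have \<psi>\<phi>: "\<psi> (\<phi> c) = c" if "c \<in> space ?M" for c
      using that unfolding \<psi>_def by (auto simp: fun_eq_iff coord space_PiM PiE_def extensional_def)
    have \<phi>\<psi>: "\<phi> (\<psi> y) = y" if "y \<in> V" for y
    proof -
      have "\<phi> (\<psi> y) = (\<Sum>b\<in>B. (b \<bullet> y / (b \<bullet> b)) *\<^sub>R b)"
        unfolding \<phi>_def \<psi>_def
        by (intro sum.cong) (simp_all add: B(2) dot_square_norm inner_commute)
      moreover have "y - \<phi> (\<psi> y) \<in> span B"
        unfolding B(3) using V that in_V by (rule subspace_diff)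
      \<comment> \<open>\<phi> (\<psi> \<open>y\<close>) is the orthogonal projection of
        \<open>y\<close> onto \<open>span B\<close>. The remainder is orthogonal to
        \<open>span B\<close> and also lies in it, hence it is orthogonal to itself.\<close>
      ultimately have "orthogonal (y - \<phi> (\<psi> y)) (y - \<phi> (\<psi> y))"
        using Gram_Schmidt_step[OF B(1), of "y - \<phi> (\<psi> y)" y] by metis
      then show ?thesis by (simp add: orthogonal_def)
    qed
    define N where "N = \<psi> -` C \<inter> V"
    have "N \<in> sets (restrict_space borel V)"
      using measurable_sets[OF \<psi> C(1)] by (simp add: N_def space_restrict_space)
    moreover have "\<phi> -` N \<inter> space ?M = C"
      using \<psi>\<phi> in_V sets.sets_into_space[OF C(1)] by (auto simp: N_def)
    moreover have "S \<subseteq> N"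
    proof
      fix y assume y: "y \<in> S"
      then have "y \<in> V" using S by blast
      have "\<psi> y \<in> space ?M" by (simp add: \<psi>_def space_PiM)
      then have "\<psi> y \<in> C" using C(3) y \<phi>\<psi>[OF \<open>y \<in> V\<close>] by auto
      then show "y \<in> N" using \<open>y \<in> V\<close> by (simp add: N_def)
    qed
    ultimately show "negligible_wrt (subspace_lborel V) S"
      unfolding negligible_wrt_def M_V using C(2) by (auto simp: emeasure_distr[OF \<phi>])
  qed
qed

section \<open>Points where rays in direction \<theta> leave the domain\<close>

lemma dir_dist_eqI:
  assumes "0 \<le> t" "\<And>u. 0 \<le> u \<Longrightarrow> u < t \<Longrightarrow> x + u *\<^sub>R \<theta> \<in> \<Omega>" "x + t *\<^sub>R \<theta> \<notin> \<Omega>"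
  shows "dir_dist \<Omega> \<theta> x = t"
proof -
  have "{s. 0 \<le> s \<and> (\<forall>u\<in>{0..<s}. x + u *\<^sub>R \<theta> \<in> \<Omega>)} = {0..t}"
    using assms by (auto simp: not_less intro: leI)
  then show ?thesis unfolding dir_dist_def using assms(1) by simp
qed

text \<open>The ray that starts at distance \<open>s\<close> behind \<open>z\<close> stays in
  \<Omega> until it reaches \<open>z\<close>. Letting \<open>s\<close> vary puts a whole segment
  into the fibre of \<open>dir_proj\<close> over \<open>z\<close>.\<close>

lemma dir_proj_diff_scaleR:
  assumes "z \<notin> \<Omega>" "\<And>t. 0 < t \<Longrightarrow> t \<le> s \<Longrightarrow> z - t *\<^sub>R \<theta> \<in> \<Omega>" "0 \<le> s"
  shows "dir_proj \<Omega> \<theta> (z - s *\<^sub>R \<theta>) = z"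
proof -
  have "dir_dist \<Omega> \<theta> (z - s *\<^sub>R \<theta>) = s"
  proof (rule dir_dist_eqI)
    show "z - s *\<^sub>R \<theta> + u *\<^sub>R \<theta> \<in> \<Omega>" if "0 \<le> u" "u < s" for u
      using assms(2)[of "s - u"] that by (simp add: algebra_simps)
  qed (use assms in simp_all)
  then show ?thesis by (simp add: dir_proj_def)
qed

context
  fixes \<Omega> :: "'a::euclidean_space set" and \<theta> :: 'a
  assumes open_dom: "open \<Omega>" and bounded_dom: "bounded \<Omega>" and unit_dir: "norm \<theta> = 1"
begin

text \<open>The path from \<open>x\<close> to its exit point ends with such a segment, and
  conversely the rear end of the segment is a point that \<open>dir_proj\<close> sends to
  \<open>z\<close>. This local description yields both the measurability of \<open>dir_bd\<close>
  and the segments used with Fubini.\<close>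

lemma mem_dir_bd_iff:
  "z \<in> dir_bd \<Omega> \<theta> \<longleftrightarrow> z \<notin> \<Omega> \<and> (\<exists>s>0. \<forall>t\<in>{0<..s}. z - t *\<^sub>R \<theta> \<in> \<Omega>)"
proof
  assume "z \<in> dir_bd \<Omega> \<theta>"
  then obtain x where x: "x \<in> \<Omega>" "z = dir_proj \<Omega> \<theta> x" unfolding dir_bd_def by blast
  let ?d = "dir_dist \<Omega> \<theta> x"
  have z: "z \<notin> \<Omega>"
    using dir_proj_in_bd[OF open_dom bounded_dom unit_dir x(1)] x(2) by (simp add: bd_def)
  then have "?d \<noteq> 0" using x by (auto simp: dir_proj_def)
  then have "?d > 0" using dir_dist_nonneg[OF open_dom bounded_dom unit_dir, of x] by simp
  moreover have "z - t *\<^sub>R \<theta> \<in> \<Omega>" if t: "t \<in> {0<..?d}" for t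
  proof -
    obtain m where "m > ?d - t" "\<forall>u\<in>{0..m}. x + u *\<^sub>R \<theta> \<in> \<Omega>"
      using less_dir_dist_iff[OF open_dom bounded_dom unit_dir, of "?d - t" x] t by auto
    then have "x + (?d - t) *\<^sub>R \<theta> \<in> \<Omega>" using t by simp
    then show ?thesis by (simp add: x(2) dir_proj_def algebra_simps)
  qed
  ultimately show "z \<notin> \<Omega> \<and> (\<exists>s>0. \<forall>t\<in>{0<..s}. z - t *\<^sub>R \<theta> \<in> \<Omega>)" using z by blast
next
  assume "z \<notin> \<Omega> \<and> (\<exists>s>0. \<forall>t\<in>{0<..s}. z - t *\<^sub>R \<theta> \<in> \<Omega>)"
  then obtain s where "z \<notin> \<Omega>" "s > 0" and s: "\<And>t. 0 < t \<Longrightarrow> t \<le> s \<Longrightarrow> z - t *\<^sub>R \<theta> \<in> \<Omega>" by auto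
  then have "dir_proj \<Omega> \<theta> (z - s *\<^sub>R \<theta>) = z" by (intro dir_proj_diff_scaleR) auto
  then show "z \<in> dir_bd \<Omega> \<theta>" unfolding dir_bd_def using s[of s] \<open>s > 0\<close> by force
qed

text \<open>Containing a compact segment behind \<open>z\<close> is an open condition on
  \<open>z\<close>. The half-open segment in \<open>mem_dir_bd_iff\<close> is exhausted by countably
  many compact ones, and its length may be taken of the form 1/(n+1).\<close>

lemma dir_bd_borel: "dir_bd \<Omega> \<theta> \<in> sets borel"
proof -
  define U where "U a b = {z. \<forall>t\<in>{a..b}. z - t *\<^sub>R \<theta> \<in> \<Omega>}" for a b
  have "open (U a b)" for a b
  proof -
    \<comment> \<open>Seen from its rear end \<open>z - b *\<^sub>R \<theta>\<close>, the backward
      segment is a forward segment of length \<open>b - a\<close>, to which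
      \<open>open_segment_dom\<close> applies. For \<open>a > b\<close> both sides are the whole
      space.\<close>
    have "U a b = (\<lambda>z. z - b *\<^sub>R \<theta>) -` {x. \<forall>t\<in>{0..b - a}. x + t *\<^sub>R \<theta> \<in> \<Omega>}" (is "_ = ?R")
    proof (intro set_eqI iffI)
      fix z assume z: "z \<in> U a b"
      have "z - b *\<^sub>R \<theta> + t *\<^sub>R \<theta> \<in> \<Omega>" if "t \<in> {0..b - a}" for t
        using z[unfolded U_def, simplified, rule_format, of "b - t"] that
        by (simp add: algebra_simps)
      then show "z \<in> ?R" by simp
    next
      fix z assume z: "z \<in> ?R"
      have "z - t *\<^sub>R \<theta> \<in> \<Omega>" if "t \<in> {a..b}" for t
        using z[simplified, rule_format, of "b - t"] that by (simp add: algebra_simps)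
      then show "z \<in> U a b" by (simp add: U_def)
    qed
    moreover have "open ?R"
      by (intro open_vimage open_segment_dom[OF open_dom bounded_dom unit_dir] continuous_intros)
    ultimately show ?thesis by simp
  qed
  moreover have "dir_bd \<Omega> \<theta> = - \<Omega> \<inter> (\<Union>n. \<Inter>k. U (inverse (real (Suc k))) (inverse (real (Suc n))))"
    (is "_ = _ \<inter> ?W")
  proof -
    have "(\<exists>s>0. \<forall>t\<in>{0<..s}. z - t *\<^sub>R \<theta> \<in> \<Omega>) \<longleftrightarrow> z \<in> ?W" for z
    proof
      assume "\<exists>s>0. \<forall>t\<in>{0<..s}. z - t *\<^sub>R \<theta> \<in> \<Omega>"
      then obtain s where s: "s > 0" "\<And>t. t \<in> {0<..s} \<Longrightarrow> z - t *\<^sub>R \<theta> \<in> \<Omega>" by blast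
      obtain n where "inverse (real (Suc n)) < s" using reals_Archimedean[OF s(1)] by blast
      then have "z - t *\<^sub>R \<theta> \<in> \<Omega>" if "inverse (real (Suc k)) \<le> t" "t \<le> inverse (real (Suc n))" for k t
        using that s(2)[of t] less_le_trans[OF inverse_Suc that(1)] by simp
      then have "z \<in> U (inverse (real (Suc k))) (inverse (real (Suc n)))" for k
        unfolding U_def by (auto simp del: of_nat_Suc)
      then show "z \<in> ?W" by blast
    next
      assume "z \<in> ?W"
      then obtain n where n: "\<And>k. z \<in> U (inverse (real (Suc k))) (inverse (real (Suc n)))" by blast
      have "z - t *\<^sub>R \<theta> \<in> \<Omega>" if t: "t \<in> {0<..inverse (real (Suc n))}" for t
      proof -
        obtain k where "inverse (real (Suc k)) < t" using reals_Archimedean[of t] t by auto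
        then show ?thesis using n[of k] t unfolding U_def by simp
      qed
      then show "\<exists>s>0. \<forall>t\<in>{0<..s}. z - t *\<^sub>R \<theta> \<in> \<Omega>"
        by (intro exI[of _ "inverse (real (Suc n))"]) simp
    qed
    then show ?thesis unfolding set_eq_iff Int_iff Compl_iff mem_dir_bd_iff by simp
  qed
  moreover have "- \<Omega> \<in> sets borel" using open_dom by (simp add: borel_comp)
  ultimately show ?thesis by (auto intro!: sets.Int sets.countable_UN sets.countable_INT borel_open)
qed

section \<open>The directional measure as Lebesgue measure of preimages\<close>

lemma bd_borel: "bd \<Omega> \<in> sets borel"
  unfolding bd_def using open_dom by (intro sets.Diff) simp_all

lemma sets_dir_measure: "A \<in> sets (dir_measure \<Omega> \<theta>) \<longleftrightarrow> A \<in> sets borel \<and> A \<subseteq> bd \<Omega>"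
  unfolding dir_measure_eq_distr[OF open_dom bounded_dom unit_dir]
  using bd_borel by (auto simp: sets_restrict_space_iff)

lemma
  assumes A: "A \<in> sets (dir_measure \<Omega> \<theta>)"
  shows sets_dir_proj_vimage: "{x \<in> \<Omega>. dir_proj \<Omega> \<theta> x \<in> A} \<in> sets borel"
    and emeasure_dir_measure_eq: "emeasure (dir_measure \<Omega> \<theta>) A = emeasure lborel {x \<in> \<Omega>. dir_proj \<Omega> \<theta> x \<in> A}"
proof -
  have "A \<in> sets borel" "A \<subseteq> bd \<Omega>" using A sets_dir_measure by blast+
  then have A': "A \<in> sets (restrict_space borel (bd \<Omega>))"
    using bd_borel by (simp add: sets_restrict_space_iff)
  have "{x \<in> \<Omega>. dir_proj \<Omega> \<theta> x \<in> A} = \<Omega> \<inter> dir_proj \<Omega> \<theta> -` A" by blast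
  also have "\<dots> \<in> sets borel"
    using measurable_sets_borel[OF dir_proj_measurable[OF open_dom bounded_dom unit_dir] \<open>A \<in> sets borel\<close>]
      open_dom by simp
  finally show meas: "{x \<in> \<Omega>. dir_proj \<Omega> \<theta> x \<in> A} \<in> sets borel" .
  have "emeasure (dir_measure \<Omega> \<theta>) A = (\<integral>\<^sup>+x. indicator {x \<in> \<Omega>. dir_proj \<Omega> \<theta> x \<in> A} x \<partial>lborel)"
    unfolding emeasure_dir_measure[OF open_dom bounded_dom unit_dir A']
    by (intro nn_integral_cong) (auto simp: indicator_def)
  with meas show "emeasure (dir_measure \<Omega> \<theta>) A = emeasure lborel {x \<in> \<Omega>. dir_proj \<Omega> \<theta> x \<in> A}"
    by simp
qed

text \<open>By definition every value of \<open>dir_proj\<close> on \<Omega> lies in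
  \<open>dir_bd\<close>, so the preimage whose Lebesgue measure is taken is empty.\<close>

lemma bd_minus_dir_bd_null:
  "bd \<Omega> - dir_bd \<Omega> \<theta> \<in> sets (dir_measure \<Omega> \<theta>)"
  "emeasure (dir_measure \<Omega> \<theta>) (bd \<Omega> - dir_bd \<Omega> \<theta>) = 0"
proof -
  show S: "bd \<Omega> - dir_bd \<Omega> \<theta> \<in> sets (dir_measure \<Omega> \<theta>)"
    using bd_borel dir_bd_borel by (simp add: sets_dir_measure sets.Diff)
  have empty: "{x \<in> \<Omega>. dir_proj \<Omega> \<theta> x \<in> bd \<Omega> - dir_bd \<Omega> \<theta>} = {}"
    by (auto simp: dir_bd_def)
  show "emeasure (dir_measure \<Omega> \<theta>) (bd \<Omega> - dir_bd \<Omega> \<theta>) = 0"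
    unfolding emeasure_dir_measure_eq[OF S] empty by simp
qed

lemma orth_proj_add_scaleR: "orth_proj \<theta> (x + t *\<^sub>R \<theta>) = orth_proj \<theta> x"
proof -
  have "\<theta> \<bullet> \<theta> = 1" using unit_dir by (simp add: dot_square_norm)
  then show ?thesis by (simp add: orth_proj_def inner_add_left scaleR_add_left)
qed

lemma orth_proj_in_hyperplane: "orth_proj \<theta> x \<in> orth_hyperplane \<theta>"
proof -
  have "\<theta> \<bullet> \<theta> = 1" using unit_dir by (simp add: dot_square_norm)
  then show ?thesis by (simp add: orth_proj_def orth_hyperplane_def inner_diff_left)
qed

section \<open>Negligibility on the boundary and in the hyperplane\<close>

lemma negligible_dir_measure_iff:
  assumes A: "A \<subseteq> bd \<Omega>"
  shows "negligible_wrt (dir_measure \<Omega> \<theta>) A \<longleftrightarrow>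
    negligible_wrt (subspace_lborel (orth_hyperplane \<theta>)) (orth_proj \<theta> ` (A \<inter> dir_bd \<Omega> \<theta>))"
    (is "?L \<longleftrightarrow> ?R")
proof -
  let ?H = "orth_hyperplane \<theta>" and ?D = "dir_bd \<Omega> \<theta>"
  define B where "B = (SOME B. orthonormal_basis_of ?H B)"
  have B: "orthonormal_basis_of ?H B"
    unfolding B_def by (rule orthonormal_basis_of_ex[OF subspace_orth_hyperplane])
  note null_iff = negligible_wrt_subspace_lborel_iff[OF subspace_orth_hyperplane B_def]
  note fubini = emeasure_lborel_eq_0_iff_AE_hyperplane[OF B unit_dir]
  let ?M = "\<Pi>\<^sub>M b\<in>B. (lborel :: real measure)"
  define \<phi> where "\<phi> c = (\<Sum>b\<in>B. c b *\<^sub>R b)" for c :: "'a \<Rightarrow> real"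
  have \<phi>: "orth_proj \<theta> (\<phi> c) = \<phi> c" for c
  proof -
    have "\<phi> c \<bullet> \<theta> = 0"
      using orthonormal_basis_of_insert_hyperplane(5)[OF B unit_dir] by (simp add: \<phi>_def inner_sum_left)
    then show ?thesis by (simp add: orth_proj_def)
  qed
  show ?thesis
  proof
    assume ?L
    then obtain N where N: "N \<in> sets (dir_measure \<Omega> \<theta>)" "emeasure (dir_measure \<Omega> \<theta>) N = 0" "A \<subseteq> N"
      unfolding negligible_wrt_def by blast
    let ?E = "{x \<in> \<Omega>. dir_proj \<Omega> \<theta> x \<in> N}"
    have "AE c in ?M. AE t in lborel. \<phi> c + t *\<^sub>R \<theta> \<notin> ?E"
      using N(2) fubini[OF sets_dir_proj_vimage[OF N(1)]]
      unfolding emeasure_dir_measure_eq[OF N(1)] \<phi>_def by simp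
    then have "AE c in ?M. \<phi> c \<notin> orth_proj \<theta> ` (A \<inter> ?D)"
    proof (rule AE_mp, intro AE_I2 impI notI)
      fix c assume c: "AE t in lborel. \<phi> c + t *\<^sub>R \<theta> \<notin> ?E" and "\<phi> c \<in> orth_proj \<theta> ` (A \<inter> ?D)"
      then obtain z where z: "z \<in> A" "z \<in> ?D" "\<phi> c = orth_proj \<theta> z" by blast
      then obtain s where "z \<notin> \<Omega>" "s > 0" and s: "\<And>t. 0 < t \<Longrightarrow> t \<le> s \<Longrightarrow> z - t *\<^sub>R \<theta> \<in> \<Omega>"
        by (auto simp: mem_dir_bd_iff)
      \<comment> \<open>On the line over \<phi> \<open>c\<close> the point \<open>z\<close> has
        parameter \<open>z \<bullet> \<theta>\<close>, so these \<open>t\<close> describe the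
        segment of length \<open>s\<close> behind \<open>z\<close>. The right end is excluded
        because \<open>z\<close> is not in \<Omega>.\<close>
      have "\<phi> c + t *\<^sub>R \<theta> \<in> ?E" if t: "t \<in> {z \<bullet> \<theta> - s..<z \<bullet> \<theta>}" for t
      proof -
        have eq: "\<phi> c + t *\<^sub>R \<theta> = z - (z \<bullet> \<theta> - t) *\<^sub>R \<theta>"
          by (simp add: z(3) orth_proj_def algebra_simps)
        have "dir_proj \<Omega> \<theta> (z - (z \<bullet> \<theta> - t) *\<^sub>R \<theta>) = z"
          using s t by (intro dir_proj_diff_scaleR \<open>z \<notin> \<Omega>\<close>) auto
        moreover have "z - (z \<bullet> \<theta> - t) *\<^sub>R \<theta> \<in> \<Omega>" using s t by auto
        ultimately show ?thesis using eq z(1) N(3) by auto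
      qed
      then have "AE t in lborel. t \<notin> {z \<bullet> \<theta> - s..<z \<bullet> \<theta>}"
        using c by (auto elim!: eventually_mono)
      then have "{z \<bullet> \<theta> - s..<z \<bullet> \<theta>} \<in> null_sets lborel"
        by (subst AE_iff_null_sets) auto
      then show False using \<open>s > 0\<close> by (simp add: null_sets_def)
    qed
    then show ?R unfolding null_iff \<phi>_def[symmetric]
      using orth_proj_in_hyperplane by blast
  next
    assume ?R
    then obtain N where N: "N \<in> sets (subspace_lborel ?H)" "emeasure (subspace_lborel ?H) N = 0"
        "orth_proj \<theta> ` (A \<inter> ?D) \<subseteq> N"
      unfolding negligible_wrt_def by blast
    then have "negligible_wrt (subspace_lborel ?H) N"
      unfolding negligible_wrt_def by blast
    then have AE_N: "AE c in ?M. \<phi> c \<notin> N" unfolding null_iff \<phi>_def by blast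
    \<comment> \<open>\<open>N\<close> is measurable within the hyperplane only. The ambient Borel
      set \<open>N0\<close> has the same preimage under \<open>orth_proj\<close>, since all values
      lie in the hyperplane, and so the cylinder over \<open>N\<close> is Borel.\<close>
    obtain N0 where N0: "N0 \<in> sets borel" "N = ?H \<inter> N0"
      using N(1) by (auto simp: subspace_lborel_def Let_def sets_restrict_space)
    have P_N: "orth_proj \<theta> x \<in> N0 \<longleftrightarrow> orth_proj \<theta> x \<in> N" for x
      using orth_proj_in_hyperplane N0(2) by blast
    have P_N0: "orth_proj \<theta> -` N0 \<in> sets borel"
      by (rule measurable_sets_borel[OF borel_measurable_orth_proj N0(1)])
    \<comment> \<open>The assumption controls only the points of \<open>A\<close> in
      \<open>dir_bd\<close>. The others are covered by adding the rest of the boundary, which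
      \<open>dir_proj\<close> never hits.\<close>
    define N' where "N' = bd \<Omega> \<inter> (orth_proj \<theta> -` N0 \<union> - ?D)"
    have N': "N' \<in> sets (dir_measure \<Omega> \<theta>)"
      unfolding sets_dir_measure N'_def
      by (intro conjI sets.Int sets.Un bd_borel P_N0 borel_comp dir_bd_borel) blast
    have "{x \<in> \<Omega>. dir_proj \<Omega> \<theta> x \<in> N'} = \<Omega> \<inter> orth_proj \<theta> -` N0"
      using dir_proj_in_bd[OF open_dom bounded_dom unit_dir]
      by (auto simp: N'_def dir_bd_def dir_proj_def orth_proj_add_scaleR)
    then have "emeasure (dir_measure \<Omega> \<theta>) N' = emeasure lborel (\<Omega> \<inter> orth_proj \<theta> -` N0)"
      by (simp add: emeasure_dir_measure_eq[OF N'])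
    moreover have "emeasure lborel (\<Omega> \<inter> orth_proj \<theta> -` N0) = 0"
    proof -
      \<comment> \<open>If the base point \<phi> \<open>c\<close> is outside \<open>N\<close>, the
        entire line over it misses the cylinder.\<close>
      have "AE c in ?M. AE t in lborel. \<phi> c + t *\<^sub>R \<theta> \<notin> \<Omega> \<inter> orth_proj \<theta> -` N0"
        using AE_N
      proof (rule AE_mp, intro AE_I2 impI)
        fix c t assume "\<phi> c \<notin> N"
        then show "\<phi> c + t *\<^sub>R \<theta> \<notin> \<Omega> \<inter> orth_proj \<theta> -` N0"
          using P_N[of "\<phi> c"] by (simp add: orth_proj_add_scaleR \<phi>)
      qed
      then show ?thesis
        using fubini[of "\<Omega> \<inter> orth_proj \<theta> -` N0"] P_N0 open_dom unfolding \<phi>_def by simp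
    qed
    ultimately have "emeasure (dir_measure \<Omega> \<theta>) N' = 0" by simp
    moreover have "A \<subseteq> N'" using A N(3) P_N unfolding N'_def by blast
    ultimately show ?L unfolding negligible_wrt_def using N' by blast
  qed
qed

end

theorem corollary2p7:
  fixes \<Omega> :: "'a::euclidean_space set" and \<theta> :: 'a
  assumes "\<Omega> \<noteq> {}" and "bounded \<Omega>" and "open \<Omega>" and "\<theta> \<in> sphere 0 1"
  shows "(bd \<Omega> - dir_bd \<Omega> \<theta> \<in> sets (dir_measure \<Omega> \<theta>)
        \<and> negligible_wrt (dir_measure \<Omega> \<theta>) (bd \<Omega> - dir_bd \<Omega> \<theta>)
        \<and> emeasure (dir_measure \<Omega> \<theta>) (bd \<Omega> - dir_bd \<Omega> \<theta>) = 0)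
    \<and> (\<forall>A. A \<noteq> {} \<and> A \<subseteq> bd \<Omega> \<longrightarrow>
        (negligible_wrt (dir_measure \<Omega> \<theta>) A \<longleftrightarrow>
         negligible_wrt (subspace_lborel (orth_hyperplane \<theta>))
           (orth_proj \<theta> ` (A \<inter> dir_bd \<Omega> \<theta>))))"
proof -
  have \<theta>: "norm \<theta> = 1" using assms(4) by simp
  note null = bd_minus_dir_bd_null[OF assms(3,2) \<theta>]
  then have "negligible_wrt (dir_measure \<Omega> \<theta>) (bd \<Omega> - dir_bd \<Omega> \<theta>)"
    unfolding negligible_wrt_def by blast
  with null negligible_dir_measure_iff[OF assms(3,2) \<theta>] show ?thesis by blast
qed

end
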